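(* Let $d\ge 1$ and consider the optimal transport problem in $\mathbb{R}^d$ with cost function $c(x,y)=\frac12\|y-x\|^2$ between probability densities $\rho$ and $\mu$ on $\mathbb{R}^d$. Assume that $\rho$ and $\mu$ factorize into one-dimensional probability densities: $$\rho(x)=\prod_{l=1}^d\rho_l(x_l),\qquad \mu(y)=\prod_{l=1}^d\mu_l(y_l).$$ For each $l$, let $\pi_l(x_l,y_l)$ and $m_l(x_l)$ denote the optimal plan and the optimal map, respectively, between $\rho_l$ and $\mu_l$ for the one-dimensional cost $\frac12(y_l-x_l)^2$, and let $C_l$ be the optimal value of this one-dimensional transport problem. Then: 1. The optimal plan between $\rho$ and $\mu$ is given by $$\pi(x,y)=\prod_{l=1}^d\pi_l(x_l,y_l).$$ 2. The optimal map pushing forward $\rho$ to $\mu$ is given by $$y=m(x)=(m_1(x_1),\ldots,m_d(x_d))^T.$$ 3. The optimal value $C$ of the transport problem between $\rho$ and $\mu$ satisfies $$C=\sum_{l=1}^d C_l.$$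
   Context: For probability densities $\rho,\mu$ on $\mathbb{R}^k$ and a cost $c(x,y)$, the optimal transport problem (Kantorovich formulation) is to minimize $\int c(x,y)\,\pi(x,y)\,dx\,dy$ over all couplings $\pi$ of $\rho$ and $\mu$, i.e. all nonnegative joint distributions (probability measures on $\mathbb{R}^k\times\mathbb{R}^k$, written formally as densities $\pi(x,y)$) satisfying $\int\pi(x,y)\,dy=\rho(x)$ and $\int\pi(x,y)\,dx=\mu(y)$. The optimal value is the minimum of this problem, and an optimal plan is a coupling attaining it. An optimal map is a map $m:\mathbb{R}^k\to\mathbb{R}^k$ that pushes forward $\rho$ to $\mu$ and minimizes $\int c(x,m(x))\rho(x)\,dx$ among all maps pushing forward $\rho$ to $\mu$. The one-dimensional problems between $\rho_l$ and $\mu_l$ are the case $k=1$. The product $\prod_l\pi_l(x_l,y_l)$ denotes the product measure of the $\pi_l$ under the identification $(\mathbb{R}\times\mathbb{R})^d\cong\mathbb{R}^d\times\mathbb{R}^d$, $((x_l,y_l))_{l}\mapsto(x,y)$. Here $x_l,y_l$ denote the $l$-th coordinates of $x,y$, and $\|\cdot\|$ is the Euclidean norm. *)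

theory Defs
  imports "HOL-Probability.Probability"
begin

definition prob_density :: "('a::euclidean_space \<Rightarrow> real) \<Rightarrow> bool" where
  "prob_density f \<longleftrightarrow>
     f \<in> borel_measurable borel \<and> (\<forall>x. 0 \<le> f x) \<and> (\<integral>\<^sup>+ x. ennreal (f x) \<partial>lborel) = 1"

definition density_measure :: "('a::euclidean_space \<Rightarrow> real) \<Rightarrow> 'a measure" where
  "density_measure f = density lborel (\<lambda>x. ennreal (f x))"

text \<open>Couplings are arbitrary Borel probability measures on the product space; they need not be
  absolutely continuous.\<close>

definition couplings ::
  "('a::euclidean_space \<Rightarrow> real) \<Rightarrow> ('a \<Rightarrow> real) \<Rightarrow> ('a \<times> 'a) measure set" where
  "couplings \<rho> \<mu> = {P. prob_space P \<and> sets P = sets (borel \<Otimes>\<^sub>M borel) \<and>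
     distr P borel fst = density_measure \<rho> \<and> distr P borel snd = density_measure \<mu>}"

text \<open>Costs are meant to be nonnegative: the embedding into the extended nonnegative reals truncates negative values. The total cost
  of a plan or of a map may be infinite.\<close>

definition plan_cost :: "('a::euclidean_space \<Rightarrow> 'a \<Rightarrow> real) \<Rightarrow> ('a \<times> 'a) measure \<Rightarrow> ennreal" where
  "plan_cost c P = (\<integral>\<^sup>+ (x, y). ennreal (c x y) \<partial>P)"

definition optimal_value ::
  "('a::euclidean_space \<Rightarrow> 'a \<Rightarrow> real) \<Rightarrow> ('a \<Rightarrow> real) \<Rightarrow> ('a \<Rightarrow> real) \<Rightarrow> ennreal" where
  "optimal_value c \<rho> \<mu> = (INF P\<in>couplings \<rho> \<mu>. plan_cost c P)"

definition optimal_plan ::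
  "('a::euclidean_space \<Rightarrow> 'a \<Rightarrow> real) \<Rightarrow> ('a \<Rightarrow> real) \<Rightarrow> ('a \<Rightarrow> real) \<Rightarrow> ('a \<times> 'a) measure \<Rightarrow> bool" where
  "optimal_plan c \<rho> \<mu> P \<longleftrightarrow>
     P \<in> couplings \<rho> \<mu> \<and> (\<forall>Q\<in>couplings \<rho> \<mu>. plan_cost c P \<le> plan_cost c Q)"

definition transport_maps ::
  "('a::euclidean_space \<Rightarrow> real) \<Rightarrow> ('a \<Rightarrow> real) \<Rightarrow> ('a \<Rightarrow> 'a) set" where
  "transport_maps \<rho> \<mu> =
     {m \<in> borel_measurable borel. distr (density_measure \<rho>) borel m = density_measure \<mu>}"

definition map_cost ::
  "('a::euclidean_space \<Rightarrow> 'a \<Rightarrow> real) \<Rightarrow> ('a \<Rightarrow> real) \<Rightarrow> ('a \<Rightarrow> 'a) \<Rightarrow> ennreal" where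
  "map_cost c \<rho> m = (\<integral>\<^sup>+ x. ennreal (c x (m x) * \<rho> x) \<partial>lborel)"

definition optimal_map ::
  "('a::euclidean_space \<Rightarrow> 'a \<Rightarrow> real) \<Rightarrow> ('a \<Rightarrow> real) \<Rightarrow> ('a \<Rightarrow> real) \<Rightarrow> ('a \<Rightarrow> 'a) \<Rightarrow> bool" where
  "optimal_map c \<rho> \<mu> m \<longleftrightarrow>
     m \<in> transport_maps \<rho> \<mu> \<and> (\<forall>t\<in>transport_maps \<rho> \<mu>. map_cost c \<rho> m \<le> map_cost c \<rho> t)"

text \<open>The product measure, transported along the identification of families of pairs
  with pairs of vectors.\<close>

definition product_plan ::
  "('d::finite \<Rightarrow> (real \<times> real) measure) \<Rightarrow> ((real^'d) \<times> (real^'d)) measure" where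
  "product_plan P = distr (\<Pi>\<^sub>M l\<in>UNIV. P l) (borel \<Otimes>\<^sub>M borel)
     (\<lambda>z. (\<chi> l. fst (z l), \<chi> l. snd (z l)))"

definition product_map :: "('d::finite \<Rightarrow> real \<Rightarrow> real) \<Rightarrow> real^'d \<Rightarrow> real^'d" where
  "product_map m x = (\<chi> l. m l (x $ l))"

definition quadratic_cost :: "'a::euclidean_space \<Rightarrow> 'a \<Rightarrow> real" where
  "quadratic_cost x y = 1/2 * (norm (y - x))\<^sup>2"

end

theory Submission
  imports Defs
begin

text \<open>The quadratic cost on \<open>\<real>\<^sup>d\<close> is the sum of the quadratic costs of the coordinates, so the cost of
a coupling \<open>P\<close> of \<open>\<rho>\<close> and \<open>\<mu>\<close> is the sum of the costs of its coordinate plans, the laws of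
\<open>(x\<^sub>l, y\<^sub>l)\<close> under \<open>P\<close> (\<open>plan_cost_coord_plan\<close>). Each coordinate plan couples \<open>\<rho>\<^sub>l\<close> and \<open>\<mu>\<^sub>l\<close>,
which gives the lower bound \<open>C \<ge> (\<Sum>l. C\<^sub>l)\<close>; the product of the \<open>\<pi>\<^sub>l\<close> is a coupling of \<open>\<rho>\<close> and \<open>\<mu>\<close>
with coordinate plans \<open>\<pi>\<^sub>l\<close>, and attains the bound.

The remaining claims rest on one fact about the line (\<open>optimal_plan_concentrated\<close>): an optimal
plan of finite cost lives on the graph of a measurable map that depends only on the two marginals.
This is shown in two steps.

The first is monotonicity (\<open>optimal_plan_monotone\<close>). Draw two independent points \<open>(x, y)\<close> and
\<open>(x', y')\<close> from an optimal plan \<open>P\<close>, and output \<open>(x, y')\<close> if \<open>(x - x') \<bullet> (y - y') < 0\<close> and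
\<open>(x, y)\<close> otherwise. The event is symmetric in the two points, so the output is again a coupling of the
same marginals. Averaged with the exchanged pair, its cost is smaller by half the integral of
\<open>- (x - x') \<bullet> (y - y')\<close> over the event. Optimality makes the event null. Only finiteness of the cost
is used, not of second moments, and no part of \<open>P\<close> has to be subtracted from it.

The second uses that the marginals have no atoms. On the line, for almost every \<open>(x, y)\<close>,
almost all the mass lies weakly below and to the left or weakly above and to the right of \<open>(x, y)\<close>;
comparing the masses of half-planes gives \<open>F x = G y\<close> for the distribution functions
(\<open>optimal_plan_cdf_eq\<close>). Almost every \<open>y\<close> is a point of strict increase of \<open>G\<close>, hence determined by
\<open>G y\<close>, so \<open>y\<close> is the quantile of \<open>\<mu>\<close> at level \<open>F x\<close>.

Consequently the optimal map between \<open>\<rho>\<^sub>l\<close> and \<open>\<mu>\<^sub>l\<close> costs as much as the optimal plan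
(\<open>optimal_map_cost_eq\<close>), and the product map is optimal. For uniqueness, let \<open>P\<close> be optimal with
\<open>C < \<infinity>\<close>. Its coordinate plans are optimal, so \<open>P\<close> lives on the graph of the product of the
monotone maps, and a plan on a graph is determined by the graph and its first marginal.
An optimal map is unique because its graph carries an optimal plan.\<close>

section \<open>Densities and couplings\<close>

lemma prob_space_density_measure: "prob_density f \<Longrightarrow> prob_space (density_measure f)"
  by (intro prob_spaceI) (simp add: density_measure_def prob_density_def emeasure_density)

lemma sets_density_measure [simp, measurable_cong]: "sets (density_measure f) = sets borel"
  by (simp add: density_measure_def)

lemma space_density_measure [simp]: "space (density_measure f) = UNIV"
  by (simp add: density_measure_def)

lemma couplingsD:
  assumes "P \<in> couplings \<rho> \<mu>"
  shows "prob_space P" "sets P = sets (borel \<Otimes>\<^sub>M borel)" "distr P borel fst = density_measure \<rho>"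
    "distr P borel snd = density_measure \<mu>"
  using assms by (auto simp: couplings_def)

lemma quadratic_cost_measurable [measurable]:
  "(\<lambda>z. quadratic_cost (fst z) (snd z)) \<in> borel_measurable (borel \<Otimes>\<^sub>M borel)"
  unfolding quadratic_cost_def by measurable

lemma quadratic_cost_nonneg: "0 \<le> quadratic_cost x y"
  by (simp add: quadratic_cost_def)

lemma plan_cost_alt: "plan_cost c P = (\<integral>\<^sup>+ z. ennreal (c (fst z) (snd z)) \<partial>P)"
  by (simp add: plan_cost_def case_prod_beta')

lemma quadratic_cost_exchange:
  "quadratic_cost x y + quadratic_cost x' y' =
     quadratic_cost x y' + quadratic_cost x' y - inner (x - x') (y - y')"
  by (simp add: quadratic_cost_def power2_norm_eq_inner inner_diff_left inner_diff_right
      inner_commute algebra_simps)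

lemma measure_density_measure_singleton:
  assumes "prob_density f"
  shows "measure (density_measure f) {x} = 0"
proof -
  have "AE y in lborel. y \<noteq> x" by (rule AE_lborel_singleton)
  then have "emeasure (density_measure f) {x} = 0"
    using assms by (auto simp: density_measure_def emeasure_density prob_density_def nn_integral_0_iff_AE
      indicator_def elim!: eventually_mono)
  then show ?thesis by (simp add: measure_def)
qed

lemma real_distribution_density_measure:
  fixes f :: "real \<Rightarrow> real"
  assumes "prob_density f"
  shows "real_distribution (density_measure f)"
proof -
  interpret prob_space "density_measure f" by (rule prob_space_density_measure[OF assms])
  show ?thesis by unfold_locales (auto simp: density_measure_def)
qed

lemma measure_density_measure_lessThan:
  fixes f :: "real \<Rightarrow> real"
  assumes f: "prob_density f"
  shows "measure (density_measure f) {..<x} = cdf (density_measure f) x"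
proof -
  interpret real_distribution "density_measure f" by (rule real_distribution_density_measure[OF f])
  have "{..x} = {..<x} \<union> {x}" by auto
  then have "cdf (density_measure f) x = measure (density_measure f) {..<x} + measure (density_measure f) {x}"
    unfolding cdf_def by (subst finite_measure_Union[symmetric]) auto
  then show ?thesis by (simp add: measure_density_measure_singleton[OF f])
qed

section \<open>Monotonicity of optimal plans for the quadratic cost\<close>

text \<open>Almost surely, two independent draws from an optimal plan of finite cost are monotonically
ordered. In dimension one this says that almost no two pairs cross.\<close>

lemma optimal_plan_monotone:
  fixes P :: "('a::euclidean_space \<times> 'a) measure"
  assumes opt: "optimal_plan quadratic_cost \<rho> \<mu> P" and fin: "plan_cost quadratic_cost P < \<infinity>"
  shows "AE z in P \<Otimes>\<^sub>M P. 0 \<le> inner (fst (fst z) - fst (snd z)) (snd (fst z) - snd (snd z))"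
proof -
  have P: "P \<in> couplings \<rho> \<mu>" using opt by (simp add: optimal_plan_def)
  note sP [measurable_cong, simp] = couplingsD(2)[OF P]
  interpret P: prob_space P by (rule couplingsD(1)[OF P])
  interpret PP: pair_prob_space P P ..
  let ?B = "borel :: 'a measure"
  let ?M = "P \<Otimes>\<^sub>M P"
  define S where "S = {z :: ('a \<times> 'a) \<times> ('a \<times> 'a).
    inner (fst (fst z) - fst (snd z)) (snd (fst z) - snd (snd z)) < 0}"
  \<comment> \<open>\<open>S\<close>: the draws cross; \<open>\<tau>\<close>: exchange of the draws; \<open>\<phi>\<close>: the first draw, sent to the
    target of the second draw on \<open>S\<close>. The competitor is the law of \<open>\<phi>\<close>.\<close>
  define \<tau> where "\<tau> z = (snd z, fst z)" for z :: "('a \<times> 'a) \<times> ('a \<times> 'a)"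
  define \<phi> where "\<phi> z = (fst (fst z), if z \<in> S then snd (snd z) else snd (fst z))"
    for z :: "('a \<times> 'a) \<times> ('a \<times> 'a)"
  have spP [simp]: "space P = UNIV"
    using sets_eq_imp_space_eq[OF sP] by (simp add: space_pair_measure)
  have S [measurable]: "Measurable.pred ?M (\<lambda>z. z \<in> S)"
    unfolding S_def mem_Collect_eq by measurable
  have Sset [measurable]: "S \<in> sets ?M"
    using S by (simp add: pred_def space_pair_measure)
  have \<tau>S: "\<tau> z \<in> S \<longleftrightarrow> z \<in> S" for z
    by (simp add: S_def \<tau>_def inner_diff_left inner_diff_right algebra_simps)
  have \<tau>_meas [measurable]: "\<tau> \<in> ?M \<rightarrow>\<^sub>M ?M" unfolding \<tau>_def by measurable
  have swap: "(\<integral>\<^sup>+z. f z \<partial>?M) = (\<integral>\<^sup>+z. f (\<tau> z) \<partial>?M)" if [measurable]: "f \<in> borel_measurable ?M" for f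
  proof -
    have "(\<integral>\<^sup>+z. f z \<partial>?M) = (\<integral>\<^sup>+z. f z \<partial>distr ?M ?M \<tau>)"
      using PP.distr_pair_swap by (simp add: \<tau>_def[abs_def] case_prod_beta')
    then show ?thesis by (simp add: nn_integral_distr)
  qed
  have swapS: "(\<integral>\<^sup>+z. f z * indicator S z \<partial>?M) = (\<integral>\<^sup>+z. f (snd z, fst z) * indicator S z \<partial>?M)"
    if [measurable]: "f \<in> borel_measurable ?M" for f
    by (subst swap, measurable) (simp add: indicator_def \<tau>S, simp add: \<tau>_def)
  have \<phi> [measurable]: "\<phi> \<in> ?M \<rightarrow>\<^sub>M ?B \<Otimes>\<^sub>M ?B" unfolding \<phi>_def by measurable
  have first: "(\<integral>\<^sup>+z. f (fst z) \<partial>?M) = (\<integral>\<^sup>+z. f z \<partial>P)" if [measurable]: "f \<in> borel_measurable P" for f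
    by (simp add: P.nn_integral_fst[symmetric] P.emeasure_space_1[unfolded spP])
  define Q where "Q = distr ?M (?B \<Otimes>\<^sub>M ?B) \<phi>"
  \<comment> \<open>Exchanging on a set that is invariant under the swap does not change the law of the target.\<close>
  have snd_marg: "(\<integral>\<^sup>+z. f (snd (\<phi> z)) \<partial>?M) = (\<integral>\<^sup>+z. f (snd z) \<partial>P)"
    if [measurable]: "f \<in> borel_measurable ?B" for f :: "'a \<Rightarrow> ennreal"
  proof -
    have "(\<integral>\<^sup>+z. f (snd (\<phi> z)) \<partial>?M) =
        (\<integral>\<^sup>+z. f (snd (snd z)) * indicator S z + f (snd (fst z)) * indicator (-S) z \<partial>?M)"
      by (intro nn_integral_cong) (auto simp: \<phi>_def split: split_indicator)
    also have "\<dots> = (\<integral>\<^sup>+z. f (snd (snd z)) * indicator S z \<partial>?M) + (\<integral>\<^sup>+z. f (snd (fst z)) * indicator (-S) z \<partial>?M)"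
      by (intro nn_integral_add) measurable
    also have "(\<integral>\<^sup>+z. f (snd (snd z)) * indicator S z \<partial>?M) = (\<integral>\<^sup>+z. f (snd (fst z)) * indicator S z \<partial>?M)"
      by (subst swapS) simp_all
    also have "\<dots> + (\<integral>\<^sup>+z. f (snd (fst z)) * indicator (-S) z \<partial>?M) =
        (\<integral>\<^sup>+z. f (snd (fst z)) * indicator S z + f (snd (fst z)) * indicator (-S) z \<partial>?M)"
      by (intro nn_integral_add[symmetric]) measurable
    also have "\<dots> = (\<integral>\<^sup>+z. f (snd (fst z)) \<partial>?M)"
      by (intro nn_integral_cong) (auto split: split_indicator)
    also have "\<dots> = (\<integral>\<^sup>+z. f (snd z) \<partial>P)" by (rule first) measurable
    finally show ?thesis .
  qed
  have "distr Q borel fst = distr P borel fst"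
  proof (rule measure_eqI)
    fix A assume "A \<in> sets (distr Q borel fst)"
    then have [measurable]: "A \<in> sets borel" by simp
    have "emeasure (distr Q borel fst) A = (\<integral>\<^sup>+z. indicator A (fst (fst z)) \<partial>?M)"
      by (simp add: Q_def nn_integral_distr flip: nn_integral_indicator) (simp add: \<phi>_def)
    also have "\<dots> = (\<integral>\<^sup>+z. indicator A (fst z) \<partial>P)" by (rule first) measurable
    also have "\<dots> = emeasure (distr P borel fst) A"
      by (simp add: nn_integral_distr flip: nn_integral_indicator)
    finally show "emeasure (distr Q borel fst) A = emeasure (distr P borel fst) A" .
  qed simp
  moreover have "distr Q borel snd = distr P borel snd"
  proof (rule measure_eqI)
    fix A assume "A \<in> sets (distr Q borel snd)"
    then have [measurable]: "A \<in> sets borel" by simp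
    have "emeasure (distr Q borel snd) A = (\<integral>\<^sup>+z. indicator A (snd (\<phi> z)) \<partial>?M)"
      by (simp add: Q_def nn_integral_distr flip: nn_integral_indicator)
    also have "\<dots> = (\<integral>\<^sup>+z. indicator A (snd z) \<partial>P)" by (rule snd_marg) measurable
    also have "\<dots> = emeasure (distr P borel snd) A"
      by (simp add: nn_integral_distr flip: nn_integral_indicator)
    finally show "emeasure (distr Q borel snd) A = emeasure (distr P borel snd) A" .
  qed simp
  moreover have "prob_space Q" unfolding Q_def by (rule PP.prob_space_distr) measurable
  ultimately have "Q \<in> couplings \<rho> \<mu>"
    using couplingsD[OF P] by (simp add: couplings_def Q_def)
  then have le: "plan_cost quadratic_cost P \<le> plan_cost quadratic_cost Q"
    using opt by (simp add: optimal_plan_def)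
  let ?c = "\<lambda>x y :: 'a. ennreal (quadratic_cost x y)"
  have [measurable]: "(\<lambda>z. quadratic_cost (f z) (g z)) \<in> borel_measurable ?M"
    if "f \<in> ?M \<rightarrow>\<^sub>M ?B" "g \<in> ?M \<rightarrow>\<^sub>M ?B" for f g
    using measurable_compose[OF measurable_Pair[OF that] quadratic_cost_measurable] by simp
  define a where "a = (\<integral>\<^sup>+z. ?c (fst (fst z)) (snd (fst z)) * indicator S z \<partial>?M)"
  define b where "b = (\<integral>\<^sup>+z. ?c (fst (fst z)) (snd (fst z)) * indicator (-S) z \<partial>?M)"
  define d where "d = (\<integral>\<^sup>+z. ?c (fst (fst z)) (snd (snd z)) * indicator S z \<partial>?M)"
  define e where "e = (\<integral>\<^sup>+z. ennreal (- inner (fst (fst z) - fst (snd z)) (snd (fst z) - snd (snd z))) * indicator S z \<partial>?M)"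
  have costP: "plan_cost quadratic_cost P = a + b"
  proof -
    have "plan_cost quadratic_cost P = (\<integral>\<^sup>+z. ?c (fst (fst z)) (snd (fst z)) \<partial>?M)"
      unfolding plan_cost_alt by (rule first[symmetric]) measurable
    also have "\<dots> = a + b"
      unfolding a_def b_def
      by (subst nn_integral_add[symmetric]) (auto intro!: nn_integral_cong split: split_indicator)
    finally show ?thesis .
  qed
  have costQ: "plan_cost quadratic_cost Q = d + b"
  proof -
    have "plan_cost quadratic_cost Q = (\<integral>\<^sup>+z. ?c (fst (\<phi> z)) (snd (\<phi> z)) \<partial>?M)"
      unfolding plan_cost_alt Q_def by (subst nn_integral_distr) auto
    also have "\<dots> = d + b"
      unfolding d_def b_def
      by (subst nn_integral_add[symmetric]) (auto simp: \<phi>_def intro!: nn_integral_cong split: split_indicator)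
    finally show ?thesis .
  qed
  have a': "a = (\<integral>\<^sup>+z. ?c (fst (snd z)) (snd (snd z)) * indicator S z \<partial>?M)"
    unfolding a_def by (subst swapS) simp_all
  have d': "d = (\<integral>\<^sup>+z. ?c (fst (snd z)) (snd (fst z)) * indicator S z \<partial>?M)"
    unfolding d_def by (subst swapS) simp_all
  \<comment> \<open>Symmetrizing in the two draws lets the pointwise exchange identity be integrated.\<close>
  have "a + a = (\<integral>\<^sup>+z. ?c (fst (fst z)) (snd (fst z)) * indicator S z
        + ?c (fst (snd z)) (snd (snd z)) * indicator S z \<partial>?M)"
    by (subst nn_integral_add) (auto simp: a_def[symmetric] a'[symmetric])
  also have "\<dots> = (\<integral>\<^sup>+z. (?c (fst (fst z)) (snd (snd z)) * indicator S z
        + ?c (fst (snd z)) (snd (fst z)) * indicator S z)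
        + ennreal (- inner (fst (fst z) - fst (snd z)) (snd (fst z) - snd (snd z))) * indicator S z \<partial>?M)"
  proof (intro nn_integral_cong)
    fix z
    show "?c (fst (fst z)) (snd (fst z)) * indicator S z
        + ?c (fst (snd z)) (snd (snd z)) * indicator S z = (?c (fst (fst z)) (snd (snd z)) * indicator S z
        + ?c (fst (snd z)) (snd (fst z)) * indicator S z)
        + ennreal (- inner (fst (fst z) - fst (snd z)) (snd (fst z) - snd (snd z))) * indicator S z"
      using quadratic_cost_exchange[of "fst (fst z)" "snd (fst z)" "fst (snd z)" "snd (snd z)"]
      by (auto simp: S_def quadratic_cost_nonneg simp flip: ennreal_plus split: split_indicator)
  qed
  also have "\<dots> = (d + d) + e"
    by (subst nn_integral_add, measurable, subst nn_integral_add) (auto simp: d_def[symmetric] d'[symmetric] e_def)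
  finally have eq: "a + a = (d + d) + e" .
  have fin': "a < \<infinity>" "b < \<infinity>" using fin costP by (auto simp: ennreal_add_less_top)
  then have "a \<le> d" using le costP costQ by (auto simp: ennreal_add_left_cancel_le add.commute)
  then have "(d + d) + e \<le> d + d" unfolding eq[symmetric] by (rule add_mono) fact
  moreover have "d + d < \<infinity>"
  proof -
    have "d + d \<le> a + a" unfolding eq by simp
    also have "\<dots> < \<infinity>" using fin' by (simp add: ennreal_add_less_top)
    finally show ?thesis .
  qed
  ultimately have "e = 0"
    using ennreal_add_left_cancel_le[of "d + d" e 0] by (auto simp: top_unique)
  then have "AE z in ?M. ennreal (- inner (fst (fst z) - fst (snd z)) (snd (fst z) - snd (snd z))) * indicator S z = 0"
    unfolding e_def by (subst (asm) nn_integral_0_iff_AE) auto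
  then show ?thesis
    by eventually_elim (auto simp: S_def ennreal_eq_0_iff split: split_indicator_asm)
qed

section \<open>Optimal plans on the line\<close>

text \<open>Monotonicity of the plan compares the mass to the left of \<open>x\<close> with the mass below \<open>y\<close>. This yields
\<open>F x \<le> G y\<close> and \<open>G y \<le> F x\<close>, where passing between open and closed half-lines needs that
\<open>\<rho>\<close> and \<open>\<mu>\<close> charge no points.\<close>

lemma optimal_plan_cdf_eq:
  fixes \<rho> \<mu> :: "real \<Rightarrow> real"
  assumes \<rho>: "prob_density \<rho>" and \<mu>: "prob_density \<mu>"
    and opt: "optimal_plan quadratic_cost \<rho> \<mu> P" and fin: "plan_cost quadratic_cost P < \<infinity>"
  shows "AE z in P. cdf (density_measure \<rho>) (fst z) = cdf (density_measure \<mu>) (snd z)"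
proof -
  have P: "P \<in> couplings \<rho> \<mu>" using opt by (simp add: optimal_plan_def)
  note sP [measurable_cong, simp] = couplingsD(2)[OF P]
  interpret P: prob_space P by (rule couplingsD(1)[OF P])
  interpret PP: pair_prob_space P P ..
  have spP [simp]: "space P = UNIV"
    using sets_eq_imp_space_eq[OF sP] by (simp add: space_pair_measure)
  have sec: "{z. fst z \<in> A} \<in> P.events" "{z. snd z \<in> A} \<in> P.events"
    if [measurable]: "A \<in> sets borel" for A :: "real set"
  proof -
    have "fst -` A \<inter> space P \<in> P.events" "snd -` A \<inter> space P \<in> P.events" by measurable
    then show "{z. fst z \<in> A} \<in> P.events" "{z. snd z \<in> A} \<in> P.events" by (auto simp: vimage_def)
  qed
  have m: "measure (density_measure \<rho>) A = P.prob {z. fst z \<in> A}"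
    "measure (density_measure \<mu>) A = P.prob {z. snd z \<in> A}" if "A \<in> sets borel" for A
    using that unfolding couplingsD(3)[OF P, symmetric] couplingsD(4)[OF P, symmetric]
    by (subst measure_distr; simp add: vimage_def)+
  have "AE z in P. AE w in P. 0 \<le> (fst z - fst w) * (snd z - snd w)"
    using PP.AE_pair[OF optimal_plan_monotone[OF opt fin]] by simp
  then show ?thesis
  proof eventually_elim
    case (elim z)
    have "measure (density_measure \<rho>) {..<fst z} \<le> measure (density_measure \<mu>) {..snd z}"
      unfolding m[OF borel_open[OF open_lessThan]] m[OF borel_closed[OF closed_atMost]]
    proof (rule P.finite_measure_mono_AE)
      show "AE w in P. w \<in> {w. fst w \<in> {..<fst z}} \<longrightarrow> w \<in> {w. snd w \<in> {..snd z}}"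
        using elim by eventually_elim (auto simp: zero_le_mult_iff)
    qed (rule sec, simp)
    moreover have "measure (density_measure \<mu>) {..<snd z} \<le> measure (density_measure \<rho>) {..fst z}"
      unfolding m[OF borel_open[OF open_lessThan]] m[OF borel_closed[OF closed_atMost]]
    proof (rule P.finite_measure_mono_AE)
      show "AE w in P. w \<in> {w. snd w \<in> {..<snd z}} \<longrightarrow> w \<in> {w. fst w \<in> {..fst z}}"
        using elim by eventually_elim (auto simp: zero_le_mult_iff)
    qed (rule sec, simp)
    ultimately show ?case
      by (simp add: measure_density_measure_lessThan[OF \<rho>] measure_density_measure_lessThan[OF \<mu>] cdf_def)
  qed
qed

text \<open>Almost every point is the left endpoint of its level set of the distribution function. The exceptional
points lie in a flat piece \<open>{q<..r}\<close> with rational ends, which is null, or are right ends of flat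
pieces that contain a rational, which are countably many.\<close>

lemma AE_cdf_strictly_increases:
  fixes f :: "real \<Rightarrow> real"
  assumes f: "prob_density f"
  shows "AE y in density_measure f. \<forall>z<y. cdf (density_measure f) z < cdf (density_measure f) y"
proof -
  let ?M = "density_measure f" and ?F = "cdf (density_measure f)"
  interpret real_distribution ?M by (rule real_distribution_density_measure[OF f])
  have flat: "AE y in ?M. ?F q = ?F r \<longrightarrow> \<not> (q < y \<and> y \<le> r)" for q r
  proof (cases "q < r \<and> ?F q = ?F r")
    case True
    then have "prob {q<..r} = 0" using cdf_diff_eq[of q r] by linarith
    then have "{q<..r} \<in> null_sets ?M" by (intro null_setsI) (simp_all add: emeasure_eq_measure)
    from AE_not_in[OF this] show ?thesis by eventually_elim simp
  qed auto
  have atom: "AE y in ?M. y \<noteq> x" for x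
  proof -
    have "{x} \<in> null_sets ?M"
      using measure_density_measure_singleton[OF f]
      by (intro null_setsI) (simp_all add: emeasure_eq_measure)
    from AE_not_in[OF this] show ?thesis by eventually_elim simp
  qed
  have "AE y in ?M. \<forall>q\<in>\<rat>. \<forall>r\<in>\<rat>. ?F q = ?F r \<longrightarrow> \<not> (q < y \<and> y \<le> r)"
    by (intro AE_ball_countable' countable_rat flat)
  moreover have "AE y in ?M. \<forall>q\<in>\<rat>. y \<noteq> Sup {z. ?F z = ?F q}"
    by (intro AE_ball_countable' countable_rat atom)
  ultimately show ?thesis
  proof eventually_elim
    case (elim y)
    show ?case
    proof (rule ccontr)
      assume "\<not> ?thesis"
      then obtain z where z: "z < y" "?F y \<le> ?F z" by (meson not_less)
      obtain q where q: "q \<in> \<rat>" "z < q" "q < y" using Rats_dense_in_real[OF z(1)] by blast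
      have Fq: "?F q = ?F y"
        using z q cdf_nondecreasing[of z q] cdf_nondecreasing[of q y] by linarith
      have max: "z' \<le> y" if z': "?F z' = ?F q" for z'
      proof (rule ccontr)
        assume "\<not> z' \<le> y"
        then obtain r where r: "r \<in> \<rat>" "y < r" "r < z'"
          using Rats_dense_in_real[of y z'] by (meson not_less)
        then have "?F r = ?F q"
          using z' Fq cdf_nondecreasing[of r z'] cdf_nondecreasing[of y r] by linarith
        with elim(1) q(1) r(1) have "\<not> (q < y \<and> y \<le> r)" by metis
        then show False using q r by simp
      qed
      have "Sup {z. ?F z = ?F q} = y"
        by (rule cSup_eq_maximum) (simp_all only: mem_Collect_eq Fq max)
      then show False using elim(2) q(1) by metis
    qed
  qed
qed

text \<open>The monotone rearrangement of \<open>\<rho>\<close> into \<open>\<mu>\<close>: the quantile function of \<open>\<mu>\<close> after the distribution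
function of \<open>\<rho>\<close>. The quantile is used only at levels strictly between 0 and 1, where the set is
nonempty and bounded below; the value 0 elsewhere matters on a null set only.\<close>

definition monotone_map :: "(real \<Rightarrow> real) \<Rightarrow> (real \<Rightarrow> real) \<Rightarrow> real \<Rightarrow> real" where
  "monotone_map \<rho> \<mu> x =
     (let u = cdf (density_measure \<rho>) x
      in if 0 < u \<and> u < 1 then Inf {y. u \<le> cdf (density_measure \<mu>) y} else 0)"

lemma monotone_map_measurable:
  assumes \<rho>: "prob_density \<rho>" and \<mu>: "prob_density \<mu>"
  shows "monotone_map \<rho> \<mu> \<in> borel_measurable borel"
proof -
  interpret R: cdf_distribution "density_measure \<rho>"
    unfolding cdf_distribution_def by (rule real_distribution_density_measure[OF \<rho>])
  interpret M: cdf_distribution "density_measure \<mu>"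
    unfolding cdf_distribution_def by (rule real_distribution_density_measure[OF \<mu>])
  have "(\<lambda>u. if u \<in> {0<..<1} then M.I u else 0) \<in> borel_measurable borel"
    by (subst measurable_restrict_space_iff[symmetric]) (auto simp: M.measurable_CI)
  from measurable_compose[OF R.measurable_C this] show ?thesis
    by (simp add: monotone_map_def[abs_def] Let_def)
qed

lemma optimal_plan_concentrated:
  fixes \<rho> \<mu> :: "real \<Rightarrow> real"
  assumes \<rho>: "prob_density \<rho>" and \<mu>: "prob_density \<mu>"
    and opt: "optimal_plan quadratic_cost \<rho> \<mu> P" and fin: "plan_cost quadratic_cost P < \<infinity>"
  shows "AE z in P. snd z = monotone_map \<rho> \<mu> (fst z)"
proof -
  have P: "P \<in> couplings \<rho> \<mu>" using opt by (simp add: optimal_plan_def)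
  note sP [measurable_cong, simp] = couplingsD(2)[OF P]
  let ?F = "cdf (density_measure \<rho>)" and ?G = "cdf (density_measure \<mu>)"
  interpret M: real_distribution "density_measure \<mu>"
    by (rule real_distribution_density_measure[OF \<mu>])
  let ?good = "\<lambda>y. \<forall>z<y. ?G z < ?G y"
  have good: "AE y in density_measure \<mu>. ?good y" by (rule AE_cdf_strictly_increases[OF \<mu>])
  \<comment> \<open>At most one point of strict increase carries the value 1, and single points are null.\<close>
  have less_1: "AE y in density_measure \<mu>. ?G y < 1"
  proof -
    let ?s = "SOME y. ?good y \<and> ?G y = 1"
    have "{?s} \<in> null_sets (density_measure \<mu>)"
      using measure_density_measure_singleton[OF \<mu>]
      by (intro null_setsI) (simp_all add: M.emeasure_eq_measure)
    from AE_not_in[OF this] have "AE y in density_measure \<mu>. y \<noteq> ?s" by eventually_elim simp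
    with good show ?thesis
    proof eventually_elim
      case (elim y)
      show ?case
      proof (rule ccontr)
        assume "\<not> ?thesis"
        then have y: "?G y = 1" using M.cdf_bounded_prob[of y] by linarith
        with elim(1) have s: "?good ?s \<and> ?G ?s = 1"
          using someI[of "\<lambda>y. ?good y \<and> ?G y = 1" y] by blast
        from elim(2) have "y < ?s \<or> ?s < y" by (rule neq_iff[THEN iffD1])
        then show False
        proof
          assume "y < ?s"
          then have "?G y < ?G ?s" using s by blast
          then show False using y s by linarith
        next
          assume "?s < y"
          then have "?G ?s < ?G y" using elim(1) by blast
          then show False using y s by linarith
        qed
      qed
    qed
  qed
  have "AE y in distr P borel snd. ?good y \<and> ?G y < 1"
    unfolding couplingsD(4)[OF P] using good less_1 by (rule AE_conjI)
  then have "AE z in P. ?good (snd z) \<and> ?G (snd z) < 1"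
    by (rule AE_distrD[rotated]) measurable
  with optimal_plan_cdf_eq[OF \<rho> \<mu> opt fin] show ?thesis
  proof eventually_elim
    case (elim z)
    have "0 \<le> ?G (snd z - 1)" by (rule M.cdf_nonneg)
    also have "\<dots> < ?G (snd z)" using elim(2)[THEN conjunct1, rule_format, of "snd z - 1"] by linarith
    finally have pos: "0 < ?G (snd z)" .
    have "?G (snd z) \<le> ?G y \<longleftrightarrow> snd z \<le> y" for y
      using elim(2) M.cdf_nondecreasing[of "snd z" y] by (meson not_le)
    then have "{y. ?G (snd z) \<le> ?G y} = {snd z..}" by auto
    then show ?case using elim(1) elim(2)[THEN conjunct2] pos by (simp add: monotone_map_def)
  qed
qed

section \<open>Plans induced by maps\<close>

text \<open>The plan induced by a map \<open>m\<close>: the law of \<open>(x, m x)\<close> for \<open>x\<close> distributed with density \<open>\<rho>\<close>.\<close>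

definition graph_plan :: "('a::euclidean_space \<Rightarrow> real) \<Rightarrow> ('a \<Rightarrow> 'a) \<Rightarrow> ('a \<times> 'a) measure" where
  "graph_plan \<rho> m = distr (density_measure \<rho>) (borel \<Otimes>\<^sub>M borel) (\<lambda>x. (x, m x))"

lemma graph_plan_couplings:
  assumes \<rho>: "prob_density \<rho>" and m: "m \<in> transport_maps \<rho> \<mu>"
  shows "graph_plan \<rho> m \<in> couplings \<rho> \<mu>"
proof -
  have [measurable]: "m \<in> borel_measurable borel" using m by (simp add: transport_maps_def)
  interpret prob_space "density_measure \<rho>" by (rule prob_space_density_measure[OF \<rho>])
  have "prob_space (graph_plan \<rho> m)"
    unfolding graph_plan_def by (rule prob_space_distr) measurable
  moreover have "distr (graph_plan \<rho> m) borel fst = density_measure \<rho>"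
    unfolding graph_plan_def by (subst distr_distr) (auto simp: comp_def intro: distr_id2)
  moreover have "distr (graph_plan \<rho> m) borel snd = density_measure \<mu>"
    using m unfolding graph_plan_def by (subst distr_distr) (auto simp: comp_def transport_maps_def)
  ultimately show ?thesis by (simp add: couplings_def graph_plan_def)
qed

lemma plan_cost_graph_plan:
  fixes \<rho> :: "'a::euclidean_space \<Rightarrow> real"
  assumes \<rho>: "prob_density \<rho>" and [measurable]: "m \<in> borel_measurable borel"
  shows "plan_cost quadratic_cost (graph_plan \<rho> m) = map_cost quadratic_cost \<rho> m"
proof -
  have [measurable]: "\<rho> \<in> borel_measurable borel" and nonneg: "0 \<le> \<rho> x" for x
    using \<rho> by (auto simp: prob_density_def)
  have [measurable]: "(\<lambda>x. quadratic_cost x (m x)) \<in> borel_measurable borel"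
    unfolding quadratic_cost_def by measurable
  have "plan_cost quadratic_cost (graph_plan \<rho> m) =
      (\<integral>\<^sup>+x. ennreal (quadratic_cost x (m x)) \<partial>density_measure \<rho>)"
    unfolding plan_cost_alt graph_plan_def by (subst nn_integral_distr) auto
  also have "\<dots> = map_cost quadratic_cost \<rho> m"
    unfolding density_measure_def map_cost_def
    by (subst nn_integral_density)
       (auto simp: ennreal_mult quadratic_cost_nonneg nonneg mult.commute intro!: nn_integral_cong)
  finally show ?thesis .
qed

lemma coupling_concentrated_on_graph:
  fixes \<rho> \<mu> :: "'a::euclidean_space \<Rightarrow> real"
  assumes P: "P \<in> couplings \<rho> \<mu>" and [measurable]: "T \<in> borel_measurable borel"
    and AE: "AE z in P. snd z = T (fst z)"
  shows "P = graph_plan \<rho> T" and "T \<in> transport_maps \<rho> \<mu>"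
proof -
  note sP [measurable_cong, simp] = couplingsD(2)[OF P]
  have "P = distr P (borel \<Otimes>\<^sub>M borel) (\<lambda>z. z)"
    by (rule distr_id2[symmetric]) simp
  also have "\<dots> = distr P (borel \<Otimes>\<^sub>M borel) (\<lambda>z. (fst z, T (fst z)))"
    by (rule distr_cong_AE) (use AE in \<open>auto elim!: eventually_mono simp: prod_eq_iff\<close>)
  also have "\<dots> = graph_plan \<rho> T"
    unfolding graph_plan_def couplingsD(3)[OF P, symmetric]
    by (subst distr_distr) (auto simp: comp_def)
  finally show eq: "P = graph_plan \<rho> T" .
  have "density_measure \<mu> = distr (graph_plan \<rho> T) borel snd"
    using couplingsD(4)[OF P] eq by simp
  also have "\<dots> = distr (density_measure \<rho>) borel T"
    unfolding graph_plan_def by (subst distr_distr) (auto simp: comp_def)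
  finally show "T \<in> transport_maps \<rho> \<mu>" by (simp add: transport_maps_def)
qed

text \<open>On the line, an optimal map does as well as an optimal plan: if the cost of the plan is finite, the
plan is induced by the monotone rearrangement, which is then a competitor of the map.\<close>

lemma optimal_map_cost_eq:
  fixes \<rho> \<mu> :: "real \<Rightarrow> real"
  assumes \<rho>: "prob_density \<rho>" and \<mu>: "prob_density \<mu>"
    and P: "optimal_plan quadratic_cost \<rho> \<mu> P" and m: "optimal_map quadratic_cost \<rho> \<mu> m"
  shows "map_cost quadratic_cost \<rho> m = plan_cost quadratic_cost P"
proof (rule antisym)
  have P': "P \<in> couplings \<rho> \<mu>" using P by (simp add: optimal_plan_def)
  have m': "m \<in> transport_maps \<rho> \<mu>" "m \<in> borel_measurable borel"
    using m by (auto simp: optimal_map_def transport_maps_def)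
  have "plan_cost quadratic_cost P \<le> plan_cost quadratic_cost (graph_plan \<rho> m)"
    using P graph_plan_couplings[OF \<rho> m'(1)] by (simp add: optimal_plan_def)
  then show "plan_cost quadratic_cost P \<le> map_cost quadratic_cost \<rho> m"
    by (simp add: plan_cost_graph_plan[OF \<rho> m'(2)])
  show "map_cost quadratic_cost \<rho> m \<le> plan_cost quadratic_cost P"
  proof (cases "plan_cost quadratic_cost P < \<infinity>")
    case True
    note T = monotone_map_measurable[OF \<rho> \<mu>]
    note graph = coupling_concentrated_on_graph[OF P' T optimal_plan_concentrated[OF \<rho> \<mu> P True]]
    have "map_cost quadratic_cost \<rho> m \<le> map_cost quadratic_cost \<rho> (monotone_map \<rho> \<mu>)"
      using m graph(2) by (simp add: optimal_map_def)
    also have "\<dots> = plan_cost quadratic_cost P"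
      by (subst graph(1)) (rule plan_cost_graph_plan[OF \<rho> T, symmetric])
    finally show ?thesis .
  qed (simp add: not_less top_unique)
qed

section \<open>Product measures and factorized densities\<close>

lemma distr_PiM_UNIV:
  fixes M :: "'i::finite \<Rightarrow> 'a measure"
  assumes M: "\<And>i. prob_space (M i)" and f: "\<And>i. f i \<in> M i \<rightarrow>\<^sub>M N i"
  shows "distr (PiM UNIV M) (PiM UNIV N) (\<lambda>\<omega> i. f i (\<omega> i)) = PiM UNIV (\<lambda>i. distr (M i) (N i) (f i))"
proof -
  note f [measurable]
  interpret M: product_prob_space M by (intro product_prob_spaceI M)
  interpret D: product_prob_space "\<lambda>i. distr (M i) (N i) (f i)"
    by (intro product_prob_spaceI prob_space.prob_space_distr M f)
  have meas: "(\<lambda>\<omega> i. f i (\<omega> i)) \<in> PiM UNIV M \<rightarrow>\<^sub>M PiM UNIV N"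
    by (rule measurable_PiM_single') (auto dest: measurable_space[OF f] simp: space_PiM)
  show ?thesis
  proof (rule D.PiM_eqI)
    show "sets (distr (PiM UNIV M) (PiM UNIV N) (\<lambda>\<omega> i. f i (\<omega> i))) = sets (PiM UNIV (\<lambda>i. distr (M i) (N i) (f i)))"
      by (auto intro!: sets_PiM_cong)
    fix A assume A: "\<And>i. i \<in> UNIV \<Longrightarrow> A i \<in> sets (distr (M i) (N i) (f i))"
    then have [measurable]: "A i \<in> sets (N i)" for i by auto
    have "(\<lambda>\<omega> i. f i (\<omega> i)) -` (Pi\<^sub>E UNIV A) \<inter> space (PiM UNIV M) = Pi\<^sub>E UNIV (\<lambda>i. f i -` A i \<inter> space (M i))"
      by (auto simp: space_PiM PiE_def Pi_def)
    then have "emeasure (distr (PiM UNIV M) (PiM UNIV N) (\<lambda>\<omega> i. f i (\<omega> i))) (Pi\<^sub>E UNIV A)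
        = emeasure (PiM UNIV M) (Pi\<^sub>E UNIV (\<lambda>i. f i -` A i \<inter> space (M i)))"
      by (subst emeasure_distr[OF meas]) (auto intro!: sets_PiM_I_finite)
    also have "\<dots> = (\<Prod>i\<in>UNIV. emeasure (M i) (f i -` A i \<inter> space (M i)))"
      by (intro M.emeasure_PiM) auto
    also have "\<dots> = (\<Prod>i\<in>UNIV. emeasure (distr (M i) (N i) (f i)) (A i))"
      by (simp add: emeasure_distr)
    finally show "emeasure (distr (PiM UNIV M) (PiM UNIV N) (\<lambda>\<omega> i. f i (\<omega> i))) (Pi\<^sub>E UNIV A)
        = (\<Prod>i\<in>UNIV. emeasure (distr (M i) (N i) (f i)) (A i))" .
  qed simp
qed

lemma measurable_vec_nth [measurable]: "(\<lambda>x :: real^'n. x $ i) \<in> borel_measurable borel"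
  by (intro borel_measurable_continuous_onI continuous_intros)

lemma borel_measurable_vecI:
  assumes "\<And>i. (\<lambda>x. f x $ i) \<in> borel_measurable M"
  shows "(f :: 'a \<Rightarrow> real^'n) \<in> borel_measurable M"
  using assms by (subst borel_measurable_euclidean_space) (auto simp: Basis_vec_def inner_axis)

lemma measurable_vec_lambda [measurable]:
  "vec_lambda \<in> PiM UNIV (\<lambda>_::'n::finite. borel) \<rightarrow>\<^sub>M (borel :: (real^'n) measure)"
  by (rule borel_measurable_vecI) simp

lemma measurable_vec_lambda_PiM:
  assumes "\<And>l. sets (M l) = sets borel"
  shows "vec_lambda \<in> PiM UNIV M \<rightarrow>\<^sub>M (borel :: (real^'n::finite) measure)"
  using assms measurable_vec_lambda
  by (subst measurable_cong_sets[OF sets_PiM_cong[where N="\<lambda>_. borel"] refl]) auto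

text \<open>The library builds \<open>lborel\<close> as a product over the canonical basis; on \<open>\<real>\<^sup>n\<close> it is the product over
the index type, which matches a density that factorizes over the coordinates.\<close>

lemma lborel_vec:
  "(lborel :: (real^'n) measure) = distr (PiM UNIV (\<lambda>_::'n::finite. lborel)) borel vec_lambda"
proof (rule lborel_eqI)
  interpret product_sigma_finite "\<lambda>_::'n. lborel :: real measure" ..
  have [measurable]: "vec_lambda \<in> PiM UNIV (\<lambda>_::'n. lborel) \<rightarrow>\<^sub>M (borel :: (real^'n) measure)"
    by (rule borel_measurable_vecI) simp
  fix l u :: "real^'n" assume le: "\<And>b. b \<in> Basis \<Longrightarrow> l \<bullet> b \<le> u \<bullet> b"
  have le': "l $ i \<le> u $ i" for i
    using le[of "axis i 1"] by (simp add: inner_axis)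
  have "vec_lambda -` box l u \<inter> space (PiM UNIV (\<lambda>_::'n. lborel)) = Pi\<^sub>E UNIV (\<lambda>i. {l $ i <..< u $ i})"
    by (auto simp: space_PiM mem_box_cart PiE_def Pi_def)
  then have "emeasure (distr (PiM UNIV (\<lambda>_::'n. lborel)) borel vec_lambda) (box l u)
      = emeasure (PiM UNIV (\<lambda>_::'n. lborel)) (Pi\<^sub>E UNIV (\<lambda>i. {l $ i <..< u $ i}))"
    by (simp add: emeasure_distr)
  also have "\<dots> = (\<Prod>i\<in>UNIV. ennreal (u $ i - l $ i))"
    by (subst emeasure_PiM) (auto simp: le')
  also have "\<dots> = ennreal (\<Prod>i\<in>UNIV. u $ i - l $ i)"
    by (rule prod_ennreal) (simp add: le')
  also have "(\<Prod>i\<in>UNIV. u $ i - l $ i) = (\<Prod>b\<in>Basis. (u - l) \<bullet> b)"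
  proof -
    have B: "(Basis :: (real^'n) set) = range (\<lambda>i. axis i 1)" by (auto simp: Basis_vec_def)
    show ?thesis
      unfolding B by (subst prod.reindex) (auto simp: inj_on_def axis_eq_axis inner_axis intro!: prod.cong)
  qed
  finally show "emeasure (distr (PiM UNIV (\<lambda>_::'n. lborel)) borel vec_lambda) (box l u) =
    ennreal (\<Prod>b\<in>Basis. (u - l) \<bullet> b)" .
qed simp

lemma density_measure_prod:
  fixes \<rho> :: "real^'d \<Rightarrow> real" and \<rho>1 :: "'d::finite \<Rightarrow> real \<Rightarrow> real"
  assumes \<rho>1: "\<And>l. prob_density (\<rho>1 l)" and \<rho>: "\<And>x. \<rho> x = (\<Prod>l\<in>UNIV. \<rho>1 l (x $ l))"
  shows "density_measure \<rho> = distr (PiM UNIV (\<lambda>l. density_measure (\<rho>1 l))) borel vec_lambda"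
proof -
  interpret L: product_sigma_finite "\<lambda>_::'d. lborel :: real measure" ..
  interpret D: product_prob_space "\<lambda>l. density_measure (\<rho>1 l)"
    by (intro product_prob_spaceI prob_space_density_measure \<rho>1)
  let ?L = "PiM UNIV (\<lambda>_::'d. lborel :: real measure)"
  have [measurable]: "\<rho>1 l \<in> borel_measurable borel" and nonneg: "0 \<le> \<rho>1 l x" for l x
    using \<rho>1[of l] by (auto simp: prob_density_def)
  have [measurable]: "vec_lambda \<in> ?L \<rightarrow>\<^sub>M (borel :: (real^'d) measure)"
    by (rule borel_measurable_vecI) simp
  have [measurable]: "\<rho> \<in> borel_measurable borel"
    unfolding \<rho>[abs_def] by measurable
  have "density ?L (\<lambda>x. ennreal (\<Prod>l\<in>UNIV. \<rho>1 l (x l))) = PiM UNIV (\<lambda>l. density_measure (\<rho>1 l))"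
  proof (rule D.PiM_eqI)
    show "sets (density ?L (\<lambda>x. ennreal (\<Prod>l\<in>UNIV. \<rho>1 l (x l)))) = sets (PiM UNIV (\<lambda>l. density_measure (\<rho>1 l)))"
      by (auto intro!: sets_PiM_cong)
    fix A assume A: "\<And>i. i \<in> UNIV \<Longrightarrow> A i \<in> sets (density_measure (\<rho>1 i))"
    then have [measurable]: "A i \<in> sets borel" for i by auto
    have "emeasure (density ?L (\<lambda>x. ennreal (\<Prod>l\<in>UNIV. \<rho>1 l (x l)))) (Pi\<^sub>E UNIV A)
        = (\<integral>\<^sup>+x. ennreal (\<Prod>l\<in>UNIV. \<rho>1 l (x l)) * indicator (Pi\<^sub>E UNIV A) x \<partial>?L)"
      by (subst emeasure_density) (auto intro!: sets_PiM_I_finite)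
    also have "\<dots> = (\<integral>\<^sup>+x. (\<Prod>l\<in>UNIV. ennreal (\<rho>1 l (x l)) * indicator (A l) (x l)) \<partial>?L)"
    proof (rule nn_integral_cong)
      fix x :: "'d \<Rightarrow> real"
      show "ennreal (\<Prod>l\<in>UNIV. \<rho>1 l (x l)) * indicator (Pi\<^sub>E UNIV A) x
          = (\<Prod>l\<in>UNIV. ennreal (\<rho>1 l (x l)) * indicator (A l) (x l))"
      proof (cases "\<forall>l. x l \<in> A l")
        case True
        then show ?thesis by (simp add: PiE_def Pi_def prod_ennreal nonneg)
      next
        case False
        then obtain l where "x l \<notin> A l" by auto
        then have "\<exists>l. ennreal (\<rho>1 l (x l)) * indicator (A l) (x l) = 0" by (auto intro!: exI[of _ l])
        then have "(\<Prod>l\<in>UNIV. ennreal (\<rho>1 l (x l)) * indicator (A l) (x l)) = 0" by (intro prod_zero) auto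
        then show ?thesis using False by (auto simp: PiE_def Pi_def)
      qed
    qed
    also have "\<dots> = (\<Prod>l\<in>UNIV. \<integral>\<^sup>+x. ennreal (\<rho>1 l x) * indicator (A l) x \<partial>lborel)"
      by (rule L.product_nn_integral_prod) auto
    also have "\<dots> = (\<Prod>l\<in>UNIV. emeasure (density_measure (\<rho>1 l)) (A l))"
      by (simp add: density_measure_def emeasure_density)
    finally show "emeasure (density ?L (\<lambda>x. ennreal (\<Prod>l\<in>UNIV. \<rho>1 l (x l)))) (Pi\<^sub>E UNIV A)
        = (\<Prod>l\<in>UNIV. emeasure (density_measure (\<rho>1 l)) (A l))" .
  qed simp
  moreover have "density_measure \<rho> = distr (density ?L (\<lambda>x. ennreal (\<Prod>l\<in>UNIV. \<rho>1 l (x l)))) borel vec_lambda"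
    unfolding density_measure_def by (subst lborel_vec, subst density_distr) (auto simp: \<rho>)
  ultimately show ?thesis by simp
qed

lemma density_measure_coord:
  fixes \<rho> :: "real^'d \<Rightarrow> real" and \<rho>1 :: "'d::finite \<Rightarrow> real \<Rightarrow> real"
  assumes \<rho>1: "\<And>l. prob_density (\<rho>1 l)" and \<rho>: "\<And>x. \<rho> x = (\<Prod>l\<in>UNIV. \<rho>1 l (x $ l))"
  shows "distr (density_measure \<rho>) borel (\<lambda>x. x $ l) = density_measure (\<rho>1 l)"
proof -
  let ?D = "PiM UNIV (\<lambda>l. density_measure (\<rho>1 l))"
  have [measurable]: "vec_lambda \<in> ?D \<rightarrow>\<^sub>M (borel :: (real^'d) measure)"
    by (rule borel_measurable_vecI) simp
  have "distr (density_measure \<rho>) borel (\<lambda>x. x $ l) = distr ?D borel (\<lambda>\<omega>. \<omega> l)"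
    unfolding density_measure_prod[OF assms] by (subst distr_distr) (auto simp: comp_def)
  also have "\<dots> = distr ?D (density_measure (\<rho>1 l)) (\<lambda>\<omega>. \<omega> l)"
    by (rule distr_cong) auto
  also have "\<dots> = density_measure (\<rho>1 l)"
    by (rule distr_PiM_component) (auto intro: prob_space_density_measure \<rho>1)
  finally show ?thesis .
qed

section \<open>Decomposition of plans and maps into coordinates\<close>

text \<open>The joint law of the \<open>l\<close>-th coordinates \<open>(x\<^sub>l, y\<^sub>l)\<close> of a plan on \<open>\<real>\<^sup>d \<times> \<real>\<^sup>d\<close>.\<close>

definition coord_plan :: "'d::finite \<Rightarrow> ((real^'d) \<times> (real^'d)) measure \<Rightarrow> (real \<times> real) measure" where
  "coord_plan l P = distr P (borel \<Otimes>\<^sub>M borel) (\<lambda>z. (fst z $ l, snd z $ l))"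

lemma quadratic_cost_vec:
  fixes x y :: "real^'d"
  shows "quadratic_cost x y = (\<Sum>l\<in>UNIV. quadratic_cost (x $ l) (y $ l))"
  by (simp add: quadratic_cost_def power2_norm_eq_inner inner_vec_def sum_distrib_left
      flip: power2_eq_square)

lemma plan_cost_coord_plan:
  fixes P :: "((real^'d) \<times> (real^'d)) measure"
  assumes sP [measurable_cong, simp]: "sets P = sets (borel \<Otimes>\<^sub>M borel)"
  shows "plan_cost quadratic_cost P = (\<Sum>l\<in>UNIV. plan_cost quadratic_cost (coord_plan l P))"
proof -
  have [measurable]: "(\<lambda>z. quadratic_cost (fst z $ l) (snd z $ l)) \<in> borel_measurable P" for l
    unfolding quadratic_cost_def by measurable
  have "plan_cost quadratic_cost P =
      (\<integral>\<^sup>+z. (\<Sum>l\<in>UNIV. ennreal (quadratic_cost (fst z $ l) (snd z $ l))) \<partial>P)"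
    unfolding plan_cost_alt by (simp add: quadratic_cost_vec quadratic_cost_nonneg sum_ennreal)
  also have "\<dots> = (\<Sum>l\<in>UNIV. \<integral>\<^sup>+z. ennreal (quadratic_cost (fst z $ l) (snd z $ l)) \<partial>P)"
    by (rule nn_integral_sum) measurable
  also have "\<dots> = (\<Sum>l\<in>UNIV. plan_cost quadratic_cost (coord_plan l P))"
    unfolding plan_cost_alt coord_plan_def by (subst nn_integral_distr) auto
  finally show ?thesis .
qed

lemma product_map_measurable [measurable]:
  assumes [measurable]: "\<And>l. m l \<in> borel_measurable borel"
  shows "product_map m \<in> borel_measurable borel"
  by (rule borel_measurable_vecI) (simp add: product_map_def)

text \<open>Two densities on \<open>\<real>\<^sup>d\<close> that factorize into one-dimensional ones, so that their laws are product
measures.\<close>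

locale factorized_densities =
  fixes \<rho> \<mu> :: "real^'d \<Rightarrow> real" and \<rho>1 \<mu>1 :: "'d::finite \<Rightarrow> real \<Rightarrow> real"
  assumes \<rho>: "prob_density \<rho>" and \<mu>: "prob_density \<mu>"
    and \<rho>1: "\<And>l. prob_density (\<rho>1 l)" and \<mu>1: "\<And>l. prob_density (\<mu>1 l)"
    and \<rho>_prod: "\<And>x. \<rho> x = (\<Prod>l\<in>UNIV. \<rho>1 l (x $ l))"
    and \<mu>_prod: "\<And>y. \<mu> y = (\<Prod>l\<in>UNIV. \<mu>1 l (y $ l))"
begin

lemma coord_plan_couplings:
  assumes P: "P \<in> couplings \<rho> \<mu>"
  shows "coord_plan l P \<in> couplings (\<rho>1 l) (\<mu>1 l)"
proof -
  note sP [measurable_cong, simp] = couplingsD(2)[OF P]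
  interpret P: prob_space P by (rule couplingsD(1)[OF P])
  have "prob_space (coord_plan l P)"
    unfolding coord_plan_def by (rule P.prob_space_distr) measurable
  moreover have "distr (coord_plan l P) borel fst = density_measure (\<rho>1 l)"
    unfolding coord_plan_def
      density_measure_coord[OF \<rho>1 \<rho>_prod, symmetric] couplingsD(3)[OF P, symmetric]
    by (simp add: distr_distr comp_def)
  moreover have "distr (coord_plan l P) borel snd = density_measure (\<mu>1 l)"
    unfolding coord_plan_def
      density_measure_coord[OF \<mu>1 \<mu>_prod, symmetric] couplingsD(4)[OF P, symmetric]
    by (simp add: distr_distr comp_def)
  ultimately show ?thesis by (simp add: couplings_def coord_plan_def)
qed

lemma product_plan_couplings:
  assumes \<pi>: "\<And>l. \<pi> l \<in> couplings (\<rho>1 l) (\<mu>1 l)"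
  shows "product_plan \<pi> \<in> couplings \<rho> \<mu>" and "coord_plan l (product_plan \<pi>) = \<pi> l"
proof -
  note s\<pi> [measurable_cong, simp] = couplingsD(2)[OF \<pi>]
  note p\<pi> = couplingsD(1)[OF \<pi>]
  have [measurable]: "(\<lambda>z. \<chi> l. fst (z l)) \<in> PiM UNIV \<pi> \<rightarrow>\<^sub>M (borel :: (real^'d) measure)"
    "(\<lambda>z. \<chi> l. snd (z l)) \<in> PiM UNIV \<pi> \<rightarrow>\<^sub>M (borel :: (real^'d) measure)"
    by (rule borel_measurable_vecI; simp)+
  \<comment> \<open>Both marginals of the product plan are instances of this, with \<open>g\<close> a projection.\<close>
  have marg: "distr (PiM UNIV \<pi>) borel (\<lambda>z. \<chi> l. g (z l)) = density_measure \<nu>"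
    if g [measurable]: "g \<in> (borel \<Otimes>\<^sub>M borel) \<rightarrow>\<^sub>M borel"
      and m: "\<And>l. distr (\<pi> l) borel g = density_measure (\<nu>1 l)"
      and \<nu>1: "\<And>l. prob_density (\<nu>1 l)" and \<nu>: "\<And>x. \<nu> x = (\<Prod>l\<in>UNIV. \<nu>1 l (x $ l))"
    for g :: "real \<times> real \<Rightarrow> real" and \<nu> :: "real^'d \<Rightarrow> real" and \<nu>1
  proof -
    have g' [measurable]: "g \<in> \<pi> l \<rightarrow>\<^sub>M borel" for l by measurable
    have G: "(\<lambda>\<omega> l. g (\<omega> l)) \<in> PiM UNIV \<pi> \<rightarrow>\<^sub>M PiM UNIV (\<lambda>_. borel)"
      by (rule measurable_PiM_single') auto
    have "density_measure \<nu> = distr (PiM UNIV (\<lambda>l. distr (\<pi> l) borel g)) borel vec_lambda"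
      by (simp add: m density_measure_prod[OF \<nu>1 \<nu>])
    also have "\<dots> = distr (distr (PiM UNIV \<pi>) (PiM UNIV (\<lambda>_. borel)) (\<lambda>\<omega> l. g (\<omega> l))) borel vec_lambda"
      by (subst distr_PiM_UNIV) (auto intro: p\<pi>)
    also have "\<dots> = distr (PiM UNIV \<pi>) borel (\<lambda>z. \<chi> l. g (z l))"
      by (subst distr_distr[OF measurable_vec_lambda G]) (simp add: comp_def)
    finally show ?thesis by simp
  qed
  interpret prob_space "PiM UNIV \<pi>" by (intro prob_space_PiM p\<pi>)
  have "prob_space (product_plan \<pi>)"
    unfolding product_plan_def by (rule prob_space_distr) measurable
  moreover have "distr (product_plan \<pi>) borel fst = density_measure \<rho>"
    unfolding product_plan_def
    by (simp add: distr_distr comp_def marg[OF _ couplingsD(3)[OF \<pi>] \<rho>1 \<rho>_prod])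
  moreover have "distr (product_plan \<pi>) borel snd = density_measure \<mu>"
    unfolding product_plan_def
    by (simp add: distr_distr comp_def marg[OF _ couplingsD(4)[OF \<pi>] \<mu>1 \<mu>_prod])
  ultimately show "product_plan \<pi> \<in> couplings \<rho> \<mu>"
    by (simp add: couplings_def product_plan_def)
  have "coord_plan l (product_plan \<pi>) = distr (PiM UNIV \<pi>) (borel \<Otimes>\<^sub>M borel) (\<lambda>z. z l)"
    unfolding coord_plan_def product_plan_def by (simp add: distr_distr comp_def)
  also have "\<dots> = distr (PiM UNIV \<pi>) (\<pi> l) (\<lambda>z. z l)" by (rule distr_cong) auto
  also have "\<dots> = \<pi> l" by (rule distr_PiM_component) (auto intro: p\<pi>)
  finally show "coord_plan l (product_plan \<pi>) = \<pi> l" .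
qed

lemma product_map_transport_maps:
  assumes m: "\<And>l. m l \<in> transport_maps (\<rho>1 l) (\<mu>1 l)"
  shows "product_map m \<in> transport_maps \<rho> \<mu>"
proof -
  have [measurable]: "m l \<in> borel_measurable borel" for l
    using m[of l] by (simp add: transport_maps_def)
  have eq: "density_measure (\<mu>1 l) = distr (density_measure (\<rho>1 l)) borel (m l)" for l
    using m[of l] by (simp add: transport_maps_def)
  let ?D = "PiM UNIV (\<lambda>l. density_measure (\<rho>1 l))"
  have G: "(\<lambda>\<omega> l. m l (\<omega> l)) \<in> ?D \<rightarrow>\<^sub>M PiM UNIV (\<lambda>_. borel)"
    by (rule measurable_PiM_single') auto
  have v: "vec_lambda \<in> ?D \<rightarrow>\<^sub>M (borel :: (real^'d) measure)"
    by (rule measurable_vec_lambda_PiM) simp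
  have "density_measure \<mu> = distr (PiM UNIV (\<lambda>l. distr (density_measure (\<rho>1 l)) borel (m l))) borel vec_lambda"
    by (simp add: density_measure_prod[OF \<mu>1 \<mu>_prod] eq)
  also have "\<dots> = distr (distr ?D (PiM UNIV (\<lambda>_. borel)) (\<lambda>\<omega> l. m l (\<omega> l))) borel vec_lambda"
    by (subst distr_PiM_UNIV) (auto intro: prob_space_density_measure \<rho>1)
  also have "\<dots> = distr ?D borel (\<lambda>\<omega>. product_map m (vec_lambda \<omega>))"
    by (subst distr_distr[OF measurable_vec_lambda G]) (simp add: comp_def product_map_def)
  also have "\<dots> = distr (density_measure \<rho>) borel (product_map m)"
    unfolding density_measure_prod[OF \<rho>1 \<rho>_prod]
    by (subst distr_distr[OF _ v]) (auto simp: comp_def)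
  finally show ?thesis by (simp add: transport_maps_def)
qed

lemma coord_plan_graph_plan:
  assumes [measurable]: "\<And>l. m l \<in> borel_measurable borel"
  shows "coord_plan l (graph_plan \<rho> (product_map m)) = graph_plan (\<rho>1 l) (m l)"
  unfolding coord_plan_def graph_plan_def density_measure_coord[OF \<rho>1 \<rho>_prod, symmetric]
  by (subst distr_distr, measurable, subst distr_distr) (auto simp: comp_def product_map_def)

end

section \<open>Optimal transport between factorized densities\<close>

theorem theorem2p2:
  fixes \<rho> \<mu> :: "real^'d \<Rightarrow> real"
    and \<rho>1 \<mu>1 :: "'d::finite \<Rightarrow> real \<Rightarrow> real"
    and \<pi>1 :: "'d \<Rightarrow> (real \<times> real) measure"
    and m1 :: "'d \<Rightarrow> real \<Rightarrow> real"
  assumes "prob_density \<rho>" and "prob_density \<mu>"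
    and "\<And>l. prob_density (\<rho>1 l)" and "\<And>l. prob_density (\<mu>1 l)"
    and "\<And>x. \<rho> x = (\<Prod>l\<in>UNIV. \<rho>1 l (x $ l))"
    and "\<And>y. \<mu> y = (\<Prod>l\<in>UNIV. \<mu>1 l (y $ l))"
    and "\<And>l. optimal_plan (\<lambda>x y. 1/2 * (y - x)\<^sup>2) (\<rho>1 l) (\<mu>1 l) (\<pi>1 l)"
    and "\<And>l. optimal_map (\<lambda>x y. 1/2 * (y - x)\<^sup>2) (\<rho>1 l) (\<mu>1 l) (m1 l)"
  shows "(optimal_plan quadratic_cost \<rho> \<mu> (product_plan \<pi>1) \<and>
          (optimal_value quadratic_cost \<rho> \<mu> < \<infinity> \<longrightarrow>
            (\<forall>P. optimal_plan quadratic_cost \<rho> \<mu> P \<longrightarrow> P = product_plan \<pi>1))) \<and>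
         (optimal_map quadratic_cost \<rho> \<mu> (product_map m1) \<and>
          (optimal_value quadratic_cost \<rho> \<mu> < \<infinity> \<longrightarrow>
            (\<forall>m. optimal_map quadratic_cost \<rho> \<mu> m \<longrightarrow>
              (AE x in density_measure \<rho>. m x = product_map m1 x)))) \<and>
         optimal_value quadratic_cost \<rho> \<mu> =
           (\<Sum>l\<in>UNIV. optimal_value (\<lambda>x y. 1/2 * (y - x)\<^sup>2) (\<rho>1 l) (\<mu>1 l))"
proof -
  interpret factorized_densities \<rho> \<mu> \<rho>1 \<mu>1
    by unfold_locales (rule assms)+
  let ?q = "quadratic_cost :: real \<Rightarrow> real \<Rightarrow> real"
  let ?Q = "quadratic_cost :: real^'d \<Rightarrow> real^'d \<Rightarrow> real"
  have q_eq: "(\<lambda>x y :: real. 1/2 * (y - x)\<^sup>2) = ?q"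
    by (simp add: quadratic_cost_def fun_eq_iff)
  have opt1: "optimal_plan ?q (\<rho>1 l) (\<mu>1 l) (\<pi>1 l)" for l
    using assms(7) unfolding q_eq .
  have map1: "optimal_map ?q (\<rho>1 l) (\<mu>1 l) (m1 l)" for l
    using assms(8) unfolding q_eq .
  have \<pi>1: "\<pi>1 l \<in> couplings (\<rho>1 l) (\<mu>1 l)" for l
    using opt1 by (simp add: optimal_plan_def)
  have m1_transport: "m1 l \<in> transport_maps (\<rho>1 l) (\<mu>1 l)" for l
    using map1 by (simp add: optimal_map_def)
  then have m1 [measurable]: "m1 l \<in> borel_measurable borel" for l
    by (simp add: transport_maps_def)
  have transportD: "m \<in> borel_measurable borel" if "m \<in> transport_maps \<rho> \<mu>" for m
    using that by (simp add: transport_maps_def)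
  note split_cost = plan_cost_coord_plan[OF couplingsD(2)]
  have cost_prod: "plan_cost ?Q (product_plan \<pi>1) = (\<Sum>l\<in>UNIV. plan_cost ?q (\<pi>1 l))"
    by (simp add: split_cost[OF product_plan_couplings(1)[OF \<pi>1]] product_plan_couplings(2)[OF \<pi>1])
  have coord_le: "plan_cost ?q (\<pi>1 l) \<le> plan_cost ?q (coord_plan l P)" if "P \<in> couplings \<rho> \<mu>" for P l
    using opt1[of l] coord_plan_couplings[OF that, of l] by (simp add: optimal_plan_def)
  have opt: "optimal_plan ?Q \<rho> \<mu> (product_plan \<pi>1)"
    unfolding optimal_plan_def
    using product_plan_couplings(1)[OF \<pi>1] coord_le
    by (auto simp: cost_prod split_cost intro!: sum_mono)
  have value_eq: "optimal_value c \<rho>' \<mu>' = plan_cost c P" if "optimal_plan c \<rho>' \<mu>' P"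
    for c :: "'b::euclidean_space \<Rightarrow> 'b \<Rightarrow> real" and \<rho>' \<mu>' P
    using that unfolding optimal_value_def optimal_plan_def by (auto intro!: antisym INF_lower INF_greatest)
  have "optimal_value ?Q \<rho> \<mu> = (\<Sum>l\<in>UNIV. optimal_value ?q (\<rho>1 l) (\<mu>1 l))"
    by (simp add: value_eq[OF opt] value_eq[OF opt1] cost_prod)
  moreover have graph_eq: "P = graph_plan \<rho> (product_map (\<lambda>l. monotone_map (\<rho>1 l) (\<mu>1 l)))"
    if fin: "optimal_value ?Q \<rho> \<mu> < \<infinity>" and P: "optimal_plan ?Q \<rho> \<mu> P" for P
  proof -
    have P': "P \<in> couplings \<rho> \<mu>" using P by (simp add: optimal_plan_def)
    note sP [measurable_cong, simp] = couplingsD(2)[OF P']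
    let ?T = "\<lambda>l. monotone_map (\<rho>1 l) (\<mu>1 l)"
    have T [measurable]: "?T l \<in> borel_measurable borel" for l
      by (rule monotone_map_measurable[OF \<rho>1 \<mu>1])
    have sum_eq: "(\<Sum>l\<in>UNIV. plan_cost ?q (coord_plan l P)) = (\<Sum>l\<in>UNIV. plan_cost ?q (\<pi>1 l))"
      using value_eq[OF P] value_eq[OF opt] by (simp add: split_cost[OF P'] cost_prod)
    have sum_fin: "(\<Sum>l\<in>UNIV. plan_cost ?q (\<pi>1 l)) < \<infinity>"
      using fin by (simp add: value_eq[OF opt] cost_prod)
    \<comment> \<open>The coordinate costs of \<open>P\<close> dominate the optimal ones termwise and have the same finite sum,
      so they agree and every coordinate plan is optimal.\<close>
    have AE: "AE z in P. snd z $ l = ?T l (fst z $ l)" for l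
    proof -
      let ?r = "UNIV - {l}"
      have split: "(\<Sum>l\<in>UNIV. f l) = f l + (\<Sum>l\<in>?r. f l)" for f :: "'d \<Rightarrow> ennreal"
        by (rule sum.remove) auto
      have fin_l: "plan_cost ?q (\<pi>1 l) < \<infinity>" and fin_r: "(\<Sum>l\<in>?r. plan_cost ?q (\<pi>1 l)) < \<infinity>"
        using sum_fin unfolding split by (auto simp: ennreal_add_less_top)
      have "plan_cost ?q (coord_plan l P) + (\<Sum>l\<in>?r. plan_cost ?q (\<pi>1 l))
          \<le> plan_cost ?q (coord_plan l P) + (\<Sum>l\<in>?r. plan_cost ?q (coord_plan l P))"
        by (intro add_left_mono sum_mono coord_le[OF P'])
      also have "\<dots> = plan_cost ?q (\<pi>1 l) + (\<Sum>l\<in>?r. plan_cost ?q (\<pi>1 l))"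
        using sum_eq unfolding split .
      finally have "(\<Sum>l\<in>?r. plan_cost ?q (\<pi>1 l)) + plan_cost ?q (coord_plan l P)
          \<le> (\<Sum>l\<in>?r. plan_cost ?q (\<pi>1 l)) + plan_cost ?q (\<pi>1 l)"
        by (simp only: add.commute)
      with fin_r have le: "plan_cost ?q (coord_plan l P) \<le> plan_cost ?q (\<pi>1 l)"
        unfolding ennreal_add_left_cancel_le by (metis less_irrefl)
      have "optimal_plan ?q (\<rho>1 l) (\<mu>1 l) (coord_plan l P)"
        unfolding optimal_plan_def
      proof (intro conjI ballI)
        show "coord_plan l P \<in> couplings (\<rho>1 l) (\<mu>1 l)" by (rule coord_plan_couplings[OF P'])
        show "plan_cost ?q (coord_plan l P) \<le> plan_cost ?q R" if "R \<in> couplings (\<rho>1 l) (\<mu>1 l)" for R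
          using le opt1[of l] that unfolding optimal_plan_def by (blast intro: order_trans)
      qed
      moreover have "plan_cost ?q (coord_plan l P) < \<infinity>" using le fin_l by (rule le_less_trans)
      ultimately have "AE z in coord_plan l P. snd z = ?T l (fst z)"
        by (rule optimal_plan_concentrated[OF \<rho>1 \<mu>1])
      then have "AE z in P. snd (fst z $ l, snd z $ l) = ?T l (fst (fst z $ l, snd z $ l))"
        unfolding coord_plan_def by (rule AE_distrD[rotated]) measurable
      then show ?thesis by simp
    qed
    then have "AE z in P. \<forall>l\<in>UNIV. snd z $ l = ?T l (fst z $ l)"
      by (intro AE_finite_allI) auto
    then have "AE z in P. snd z = product_map ?T (fst z)"
      by eventually_elim (simp add: product_map_def vec_eq_iff)
    then show ?thesis
      by (rule coupling_concentrated_on_graph(1)[OF P' product_map_measurable[OF T]])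
  qed
  then have "\<forall>P. optimal_plan ?Q \<rho> \<mu> P \<longrightarrow> P = product_plan \<pi>1" if "optimal_value ?Q \<rho> \<mu> < \<infinity>"
    using that opt by metis
  moreover
  have m1_prod: "product_map m1 \<in> transport_maps \<rho> \<mu>"
    by (rule product_map_transport_maps[OF m1_transport])
  have cost_map: "map_cost ?Q \<rho> (product_map m1) = plan_cost ?Q (product_plan \<pi>1)"
  proof -
    have "map_cost ?Q \<rho> (product_map m1) = plan_cost ?Q (graph_plan \<rho> (product_map m1))"
      by (rule plan_cost_graph_plan[OF \<rho> transportD[OF m1_prod], symmetric])
    also have "\<dots> = (\<Sum>l\<in>UNIV. plan_cost ?q (graph_plan (\<rho>1 l) (m1 l)))"
      by (simp add: split_cost[OF graph_plan_couplings[OF \<rho> m1_prod]] coord_plan_graph_plan[OF m1])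
    also have "\<dots> = (\<Sum>l\<in>UNIV. plan_cost ?q (\<pi>1 l))"
      by (simp add: plan_cost_graph_plan[OF \<rho>1 m1] optimal_map_cost_eq[OF \<rho>1 \<mu>1 opt1 map1])
    finally show ?thesis by (simp add: cost_prod)
  qed
  have map_opt: "optimal_map ?Q \<rho> \<mu> (product_map m1)"
    unfolding optimal_map_def
  proof (intro conjI ballI)
    fix t assume t: "t \<in> transport_maps \<rho> \<mu>"
    have "plan_cost ?Q (product_plan \<pi>1) \<le> plan_cost ?Q (graph_plan \<rho> t)"
      using opt graph_plan_couplings[OF \<rho> t] by (simp add: optimal_plan_def)
    then show "map_cost ?Q \<rho> (product_map m1) \<le> map_cost ?Q \<rho> t"
      by (simp add: cost_map plan_cost_graph_plan[OF \<rho> transportD[OF t]])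
  qed (rule m1_prod)
  moreover have "AE x in density_measure \<rho>. m x = product_map m1 x"
    if fin: "optimal_value ?Q \<rho> \<mu> < \<infinity>" and m: "optimal_map ?Q \<rho> \<mu> m" for m
  proof -
    let ?T = "product_map (\<lambda>l. monotone_map (\<rho>1 l) (\<mu>1 l))"
    have T [measurable]: "?T \<in> borel_measurable borel"
      by (rule product_map_measurable[OF monotone_map_measurable[OF \<rho>1 \<mu>1]])
    have AE_T: "AE x in density_measure \<rho>. t x = ?T x" if t: "optimal_map ?Q \<rho> \<mu> t" for t
    proof -
      have t': "t \<in> transport_maps \<rho> \<mu>" using t by (simp add: optimal_map_def)
      note [measurable] = transportD[OF t']
      have "map_cost ?Q \<rho> t \<le> plan_cost ?Q (product_plan \<pi>1)"
        using t m1_prod by (simp add: optimal_map_def flip: cost_map)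
      then have "optimal_plan ?Q \<rho> \<mu> (graph_plan \<rho> t)"
        using opt graph_plan_couplings[OF \<rho> t']
        unfolding optimal_plan_def plan_cost_graph_plan[OF \<rho> transportD[OF t']]
        by (blast intro: order_trans)
      then have eq: "graph_plan \<rho> t = graph_plan \<rho> ?T" by (rule graph_eq[OF fin])
      have "AE z in graph_plan \<rho> ?T. snd z = ?T (fst z)"
        unfolding graph_plan_def by (subst AE_distr_iff) auto
      then have "AE z in graph_plan \<rho> t. snd z = ?T (fst z)" by (rule eq[THEN ssubst])
      then have "AE x in density_measure \<rho>. snd (x, t x) = ?T (fst (x, t x))"
        unfolding graph_plan_def by (rule AE_distrD[rotated]) measurable
      then show ?thesis by simp
    qed
    from AE_T[OF m] AE_T[OF map_opt] show ?thesis by eventually_elim simp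
  qed
  ultimately show ?thesis unfolding q_eq using opt by blast
qed

end
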